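(* Homeomorphism $\sim$ is a sound equivalence relation on weighted singly linked heaps over $P$: for all heaps $H,H'$ with $H\sim H'$, all pointer variables $x,y\in P$ and every transformer $\tau$, we have $\mathit{pathLength}(H,x,y)=\mathit{pathLength}(H',x,y)$, $\mathit{circular}(H,x)=\mathit{circular}(H',x)$, and $\tau(H)\sim\tau(H')$.
   Context: Fix a finite set $P$ of pointer variables containing a distinguished variable $\mathbf{null}$. A weighted heap over $P$ is $H=\langle L,G,w\rangle$ with $G$ a finite directed graph (vertices $V(G)$, edges $E(G)$), $w:E(G)\to\mathbb{N}_{>0}$, and $L:P\to V(G)$. $H$ is singly linked iff every vertex $v$ either has outdegree $1$ and $v\neq L(\mathbf{null})$, or has outdegree $0$ and $v=L(\mathbf{null})$; for $v\ne L(\mathbf{null})$, $\mathrm{succ}(v)$ is its unique successor. $\mathit{pathLength}(H,x,y)$ is the minimum total weight of a directed path from $L(x)$ to $L(y)$ ($0$ if $L(x)=L(y)$, $\infty$ if none). $\mathit{circular}(H,x)$ holds iff there is a non-empty directed path from $L(x)$ back to $L(x)$. Transformers (for pointer variables $x,y$): $\mathit{new}(H,x)$ adds a fresh vertex $q$, an edge $(q,L(\mathbf{null}))$ of weight $1$, and sets $L[x\mapsto q]$. $\mathit{assign}(H,x,y)$ sets $L[x\mapsto L(y)]$. $\mathit{lookup}(H,x,y)$: let $v=L(y)$; if the edge leaving $v$ has weight $1$, set $L[x\mapsto\mathrm{succ}(v)]$; otherwise first subdivide that edge into a first edge of weight $1$ to a fresh vertex $q$ followed by the remainder, and set $L[x\mapsto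 q]$. $\mathit{update}(H,x,y)$ replaces the edge leaving $L(x)$ by the edge $(L(x),L(y))$ of weight $1$. (Lookup and update are applied only where the required successor exists.) Subdividing an edge $(u,v)$: introduce a fresh vertex $q$ and replace $(u,v)$ by $(u,q),(q,v)$ with positive weights summing to $w(u,v)$; a subdivision of $H$ is obtained by finitely many (possibly zero) such steps. Reachable sub-heap $H|_P$: $H$ restricted to vertices reachable from some $L(p)$. $H,H'$ are isomorphic iff there is a weight-preserving graph isomorphism $f:H|_P\to H'|_P$ with $f(L(p))=L'(p)$ for all $p\in P$; $H\sim H'$ iff some subdivision of $H$ is isomorphic to some subdivision of $H'$. *)

theory Defs
  imports Main "HOL-Library.Extended_Nat"
begin

text \<open>
  The finite set of pointer variables is a type \<open>'p::finite\<close>; the distinguished null variable is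
  passed explicitly as \<open>nl :: 'p\<close>. Vertices are drawn from a type \<open>'v\<close>, which has to be infinite
  for fresh vertices to exist. Only the values of \<open>wt\<close> on \<open>edges\<close> are meaningful.
\<close>

record ('p, 'v) heap =
  lab :: "'p \<Rightarrow> 'v"
  verts :: "'v set"
  edges :: "('v \<times> 'v) set"
  wt :: "'v \<times> 'v \<Rightarrow> nat"

definition weighted_heap :: "('p, 'v) heap \<Rightarrow> bool" where
  "weighted_heap H \<longleftrightarrow>
     finite (verts H) \<and> edges H \<subseteq> verts H \<times> verts H \<and>
     (\<forall>e\<in>edges H. 0 < wt H e) \<and> (\<forall>p. lab H p \<in> verts H)"

definition outdegree :: "('p, 'v) heap \<Rightarrow> 'v \<Rightarrow> nat" where
  "outdegree H v = card {u. (v, u) \<in> edges H}"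

definition singly_linked :: "'p \<Rightarrow> ('p, 'v) heap \<Rightarrow> bool" where
  "singly_linked nl H \<longleftrightarrow>
     (\<forall>v\<in>verts H. (outdegree H v = 1 \<and> v \<noteq> lab H nl) \<or> (outdegree H v = 0 \<and> v = lab H nl))"

definition sl_heaps :: "'p \<Rightarrow> ('p, 'v) heap set" where
  "sl_heaps nl = {H. weighted_heap H \<and> singly_linked nl H}"

definition succ :: "('p, 'v) heap \<Rightarrow> 'v \<Rightarrow> 'v" where
  "succ H v = (THE u. (v, u) \<in> edges H)"

text \<open>A directed path is given by the non-empty list of its vertices.\<close>

definition dpath :: "('p, 'v) heap \<Rightarrow> 'v \<Rightarrow> 'v list \<Rightarrow> 'v \<Rightarrow> bool" where
  "dpath H u p v \<longleftrightarrow>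
     p \<noteq> [] \<and> hd p = u \<and> last p = v \<and> successively (\<lambda>a b. (a, b) \<in> edges H) p"

definition path_weight :: "('p, 'v) heap \<Rightarrow> 'v list \<Rightarrow> nat" where
  "path_weight H p = (\<Sum>e\<leftarrow>zip p (tl p). wt H e)"

text \<open>The infimum in \<open>enat\<close> is \<open>\<infinity>\<close> for the empty set, and a minimum otherwise.\<close>

definition path_length :: "('p, 'v) heap \<Rightarrow> 'p \<Rightarrow> 'p \<Rightarrow> enat" where
  "path_length H x y = Inf {enat (path_weight H p) | p. dpath H (lab H x) p (lab H y)}"

definition circular :: "('p, 'v) heap \<Rightarrow> 'p \<Rightarrow> bool" where
  "circular H x \<longleftrightarrow> (lab H x, lab H x) \<in> (edges H)\<^sup>+"

text \<open>Replaces the edge \<open>(u, v)\<close> by \<open>(u, q)\<close> of weight \<open>k\<close> and \<open>(q, v)\<close> of weight \<open>l\<close>.\<close>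

definition subdivide :: "'v \<Rightarrow> 'v \<Rightarrow> 'v \<Rightarrow> nat \<Rightarrow> nat \<Rightarrow> ('p, 'v) heap \<Rightarrow> ('p, 'v) heap" where
  "subdivide u v q k l H = H\<lparr>
     verts := insert q (verts H),
     edges := (edges H - {(u, v)}) \<union> {(u, q), (q, v)},
     wt := (wt H)((u, q) := k, (q, v) := l)\<rparr>"

definition subdivision_step :: "('p, 'v) heap \<Rightarrow> ('p, 'v) heap \<Rightarrow> bool" where
  "subdivision_step H K \<longleftrightarrow>
     (\<exists>u v q k l. (u, v) \<in> edges H \<and> q \<notin> verts H \<and> 0 < k \<and> 0 < l \<and> k + l = wt H (u, v) \<and>
        K = subdivide u v q k l H)"

text \<open>\<open>subdivision H K\<close>: the heap \<open>K\<close> is a subdivision of \<open>H\<close>.\<close>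

definition subdivision :: "('p, 'v) heap \<Rightarrow> ('p, 'v) heap \<Rightarrow> bool" where
  "subdivision = subdivision_step\<^sup>*\<^sup>*"

definition reachable_subheap :: "('p, 'v) heap \<Rightarrow> ('p, 'v) heap" where
  "reachable_subheap H =
     (let R = {v \<in> verts H. \<exists>p. (lab H p, v) \<in> (edges H)\<^sup>*}
      in H\<lparr>verts := R, edges := edges H \<inter> R \<times> R\<rparr>)"

definition heap_iso_map :: "('v \<Rightarrow> 'v) \<Rightarrow> ('p, 'v) heap \<Rightarrow> ('p, 'v) heap \<Rightarrow> bool" where
  "heap_iso_map f K K' \<longleftrightarrow>
     bij_betw f (verts K) (verts K') \<and>
     (\<forall>u\<in>verts K. \<forall>v\<in>verts K. (u, v) \<in> edges K \<longleftrightarrow> (f u, f v) \<in> edges K') \<and>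
     (\<forall>(u, v)\<in>edges K. wt K' (f u, f v) = wt K (u, v)) \<and>
     (\<forall>p. f (lab K p) = lab K' p)"

definition isomorphic :: "('p, 'v) heap \<Rightarrow> ('p, 'v) heap \<Rightarrow> bool" where
  "isomorphic H H' \<longleftrightarrow> (\<exists>f. heap_iso_map f (reachable_subheap H) (reachable_subheap H'))"

definition homeomorphic :: "('p, 'v) heap \<Rightarrow> ('p, 'v) heap \<Rightarrow> bool" (infix \<open>\<sim>\<^sub>h\<close> 50) where
  "H \<sim>\<^sub>h H' \<longleftrightarrow> (\<exists>K K'. subdivision H K \<and> subdivision H' K' \<and> isomorphic K K')"

text \<open>The argument \<open>q\<close> below is the fresh vertex used by the transformer.\<close>

definition new_heap :: "'p \<Rightarrow> 'v \<Rightarrow> 'p \<Rightarrow> ('p, 'v) heap \<Rightarrow> ('p, 'v) heap" where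
  "new_heap nl q x H = H\<lparr>
     lab := (lab H)(x := q),
     verts := insert q (verts H),
     edges := insert (q, lab H nl) (edges H),
     wt := (wt H)((q, lab H nl) := 1)\<rparr>"

definition assign_heap :: "'p \<Rightarrow> 'p \<Rightarrow> ('p, 'v) heap \<Rightarrow> ('p, 'v) heap" where
  "assign_heap x y H = H\<lparr>lab := (lab H)(x := lab H y)\<rparr>"

definition lookup_heap :: "'v \<Rightarrow> 'p \<Rightarrow> 'p \<Rightarrow> ('p, 'v) heap \<Rightarrow> ('p, 'v) heap" where
  "lookup_heap q x y H =
     (let v = lab H y; u = succ H v in
      if wt H (v, u) = 1 then H\<lparr>lab := (lab H)(x := u)\<rparr>
      else (subdivide v u q 1 (wt H (v, u) - 1) H)\<lparr>lab := (lab H)(x := q)\<rparr>)"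

definition update_heap :: "'p \<Rightarrow> 'p \<Rightarrow> ('p, 'v) heap \<Rightarrow> ('p, 'v) heap" where
  "update_heap x y H = H\<lparr>
     edges := insert (lab H x, lab H y) (edges H - {(lab H x, succ H (lab H x))}),
     wt := (wt H)((lab H x, lab H y) := 1)\<rparr>"

datatype 'p transformer = New 'p | Assign 'p 'p | Lookup 'p 'p | Update 'p 'p

fun transform :: "'p \<Rightarrow> 'v \<Rightarrow> 'p transformer \<Rightarrow> ('p, 'v) heap \<Rightarrow> ('p, 'v) heap" where
  "transform nl q (New x) H = new_heap nl q x H"
| "transform nl q (Assign x y) H = assign_heap x y H"
| "transform nl q (Lookup x y) H = lookup_heap q x y H"
| "transform nl q (Update x y) H = update_heap x y H"

fun applicable :: "'p transformer \<Rightarrow> ('p, 'v) heap \<Rightarrow> bool" where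
  "applicable (New x) H \<longleftrightarrow> True"
| "applicable (Assign x y) H \<longleftrightarrow> True"
| "applicable (Lookup x y) H \<longleftrightarrow> (\<exists>u. (lab H y, u) \<in> edges H)"
| "applicable (Update x y) H \<longleftrightarrow> (\<exists>u. (lab H x, u) \<in> edges H)"

end

theory Submission
  imports Defs
begin

text \<open>
  A heap is viewed as a unit-step system: the position \<open>(v, i)\<close> is the point at distance \<open>i\<close>
  from \<open>v\<close> on the edge leaving \<open>v\<close>. Subdividing an edge only renames positions, and subdividing as
  far as possible turns positions into vertices. Hence two heaps of outdegree at most one are
  homeomorphic iff a one-to-one bisimulation of their unit-step systems relates equally labelled
  positions. Path lengths, circularity and the effect of the transformers are read off from such
  a bisimulation.
\<close>

text \<open>Argued on subdivisions directly, transitivity would call for a common refinement of two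
  subdivisions of the middle heap, and every transformer would have to be commuted with subdivision.
  Bisimulations simply compose as relations, and a transformer only asks for a small adjustment of
  one relation. One-to-one matters: ordinary bisimilarity would identify a cycle of weight 1 with a
  cycle of weight 2.

  The invariant carried along is \<open>functional_heap\<close> rather than membership in
  \<open>sl_heaps\<close>, because a transformer may redirect the null variable itself, for instance
  to a vertex with an outgoing edge, and the result is then no longer singly linked.\<close>

definition functional_heap :: "('p, 'v) heap \<Rightarrow> bool" where
  "functional_heap H \<longleftrightarrow> weighted_heap H \<and> single_valued (edges H)"

text \<open>An offset that reaches the weight of the edge is written as offset 0 at its target, so
  every point has a single name. Pairs whose offset is at or beyond the weight, or whose vertex has
  no outgoing edge, are stuck.\<close>

definition unit_step :: "('p, 'v) heap \<Rightarrow> 'v \<times> nat \<Rightarrow> 'v \<times> nat \<Rightarrow> bool" where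
  "unit_step H s t \<longleftrightarrow> (\<exists>u. (fst s, u) \<in> edges H \<and>
     (Suc (snd s) < wt H (fst s, u) \<and> t = (fst s, Suc (snd s)) \<or>
      Suc (snd s) = wt H (fst s, u) \<and> t = (u, 0)))"

text \<open>This is one direction only; demanded of \<open>R\<close> and of its converse, it makes
  \<open>R\<close> a partial bijection that matches steps both ways. The condition on
  \<open>verts H\<close> keeps fresh vertices out of the domain of \<open>R\<close>.\<close>

definition unit_sim ::
  "('v \<times> nat \<Rightarrow> 'v \<times> nat \<Rightarrow> bool) \<Rightarrow> ('p, 'v) heap \<Rightarrow> ('p, 'v) heap \<Rightarrow> bool" where
  "unit_sim R H H' \<longleftrightarrow>
     (\<forall>p. R (lab H p, 0) (lab H' p, 0)) \<and>
     (\<forall>s s'. R s s' \<longrightarrow> fst s \<in> verts H) \<and>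
     (\<forall>s s' t'. R s s' \<longrightarrow> R s t' \<longrightarrow> s' = t') \<and>
     (\<forall>s s' t. R s s' \<longrightarrow> unit_step H s t \<longrightarrow> (\<exists>t'. unit_step H' s' t' \<and> R t t'))"

definition unit_bisimilar :: "('p, 'v) heap \<Rightarrow> ('p, 'v) heap \<Rightarrow> bool" where
  "unit_bisimilar H H' \<longleftrightarrow> (\<exists>R. unit_sim R H H' \<and> unit_sim R\<inverse>\<inverse> H' H)"

lemma unit_simI:
  assumes "\<And>p. R (lab H p, 0) (lab H' p, 0)"
    and "\<And>s s'. R s s' \<Longrightarrow> fst s \<in> verts H"
    and "\<And>s s' t'. R s s' \<Longrightarrow> R s t' \<Longrightarrow> s' = t'"
    and "\<And>s s' t. R s s' \<Longrightarrow> unit_step H s t \<Longrightarrow> \<exists>t'. unit_step H' s' t' \<and> R t t'"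
  shows "unit_sim R H H'"
  using assms unfolding unit_sim_def by blast

lemma unit_simD:
  assumes "unit_sim R H H'"
  shows "R (lab H p, 0) (lab H' p, 0)"
    and "R s s' \<Longrightarrow> fst s \<in> verts H"
    and "R s s' \<Longrightarrow> R s t' \<Longrightarrow> s' = t'"
    and "R s s' \<Longrightarrow> unit_step H s t \<Longrightarrow> \<exists>t'. unit_step H' s' t' \<and> R t t'"
  using assms unfolding unit_sim_def by blast+

lemma functional_heapD:
  assumes "functional_heap H"
  shows "finite (verts H)"
    and "(u, v) \<in> edges H \<Longrightarrow> u \<in> verts H"
    and "(u, v) \<in> edges H \<Longrightarrow> v \<in> verts H"
    and "e \<in> edges H \<Longrightarrow> 0 < wt H e"
    and "lab H p \<in> verts H"
    and "(u, v) \<in> edges H \<Longrightarrow> (u, w) \<in> edges H \<Longrightarrow> v = w"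
    and "finite (edges H)"
  using assms finite_subset[of "edges H" "verts H \<times> verts H"]
  unfolding functional_heap_def weighted_heap_def single_valued_def by blast+

lemma functional_heapI:
  assumes "finite (verts H)"
    and "\<And>u v. (u, v) \<in> edges H \<Longrightarrow> u \<in> verts H \<and> v \<in> verts H \<and> 0 < wt H (u, v)"
    and "\<And>p. lab H p \<in> verts H"
    and "\<And>u v w. (u, v) \<in> edges H \<Longrightarrow> (u, w) \<in> edges H \<Longrightarrow> v = w"
  shows "functional_heap H"
  using assms unfolding functional_heap_def weighted_heap_def single_valued_def by auto

lemma functional_heap_if_sl_heap:
  assumes "H \<in> sl_heaps nl"
  shows "functional_heap H"
proof -
  have wh: "weighted_heap H" and sl: "singly_linked nl H"
    using assms by (auto simp: sl_heaps_def)
  have "v = w" if "(u, v) \<in> edges H" "(u, w) \<in> edges H" for u v w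
  proof -
    \<comment> \<open>Finiteness matters here: \<open>card\<close> of an infinite set is 0, so a
      bound on \<open>outdegree\<close> alone would not bound the successors.\<close>
    have u: "u \<in> verts H" and fin: "finite {z. (u, z) \<in> edges H}"
      using wh that finite_subset[of "{z. (u, z) \<in> edges H}" "verts H"]
      by (auto simp: weighted_heap_def)
    have "card {z. (u, z) \<in> edges H} \<le> 1"
      using sl u by (auto simp: singly_linked_def outdegree_def)
    then show ?thesis using fin that by (metis One_nat_def card_le_Suc0_iff_eq mem_Collect_eq)
  qed
  then show ?thesis using wh by (auto simp: functional_heap_def single_valued_def)
qed

lemma succ_eq:
  assumes "functional_heap H" "(v, u) \<in> edges H"
  shows "succ H v = u"
  using assms functional_heapD(6)[OF assms(1)] unfolding succ_def by blast

lemma unit_bisimilar_sym: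
  assumes "unit_bisimilar H H'"
  shows "unit_bisimilar H' H"
  using assms unfolding unit_bisimilar_def by (metis conversep_conversep)

lemma unit_sim_relcompp:
  assumes "unit_sim R H K" "unit_sim S K L"
  shows "unit_sim (R OO S) H L"
  using assms by (intro unit_simI) (blast dest: unit_simD)+

lemma unit_bisimilar_trans:
  assumes "unit_bisimilar H K" "unit_bisimilar K L"
  shows "unit_bisimilar H L"
proof -
  obtain R S where R: "unit_sim R H K" "unit_sim R\<inverse>\<inverse> K H"
    and S: "unit_sim S K L" "unit_sim S\<inverse>\<inverse> L K"
    using assms unfolding unit_bisimilar_def by blast
  have "unit_sim (R OO S)\<inverse>\<inverse> L H"
    unfolding converse_relcompp using unit_sim_relcompp[OF S(2) R(2)] .
  then show ?thesis
    using unit_sim_relcompp[OF R(1) S(1)] unfolding unit_bisimilar_def by blast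
qed

section \<open>Path length and circularity as statements about unit steps\<close>

lemma unit_sim_relpowp:
  assumes "unit_sim R H H'" "(unit_step H ^^ n) s t" "R s s'"
  shows "\<exists>t'. (unit_step H' ^^ n) s' t' \<and> R t t'"
  using assms(2)
proof (induction n arbitrary: t)
  case 0
  then show ?case using assms(3) by auto
next
  case (Suc n)
  then obtain r where r: "(unit_step H ^^ n) s r" "unit_step H r t" by auto
  then obtain r' where r': "(unit_step H' ^^ n) s' r'" "R r r'" using Suc.IH by blast
  then show ?case using unit_simD(4)[OF assms(1) r'(2) r(2)] by auto
qed

text \<open>A run carries over step by step and ends at some partner of \<open>(lab H y, 0)\<close>;
  since \<open>R\<close> is single-valued, that partner is the position of the label
  \<open>y\<close> in the other heap.\<close>

lemma unit_bisimilar_relpowp_labels: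
  assumes "unit_bisimilar H H'"
  shows "(unit_step H ^^ n) (lab H x, 0) (lab H y, 0)
     \<longleftrightarrow> (unit_step H' ^^ n) (lab H' x, 0) (lab H' y, 0)"
proof -
  have one: "(unit_step K' ^^ n) (lab K' x, 0) (lab K' y, 0)"
    if "unit_sim R K K'" and "(unit_step K ^^ n) (lab K x, 0) (lab K y, 0)" for R K K'
    using unit_sim_relpowp[OF that unit_simD(1)[OF that(1)]] unit_simD(1,3)[OF that(1)] by blast
  show ?thesis using assms one unfolding unit_bisimilar_def by blast
qed

lemma unit_steps_along_edge:
  assumes "functional_heap H" "(u, v) \<in> edges H"
  shows "(unit_step H ^^ wt H (u, v)) (u, 0) (v, 0)"
proof -
  have inner: "i < wt H (u, v) \<Longrightarrow> (unit_step H ^^ i) (u, 0) (u, i)" for i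
  proof (induction i)
    case (Suc i)
    then have "unit_step H (u, i) (u, Suc i)" using assms(2) by (auto simp: unit_step_def)
    then show ?case using Suc by auto
  qed simp
  obtain k where k: "wt H (u, v) = Suc k"
    using functional_heapD(4)[OF assms] gr0_implies_Suc by blast
  then have "unit_step H (u, k) (v, 0)" using assms(2) by (auto simp: unit_step_def)
  then show ?thesis using inner[of k] k by auto
qed

lemma path_weight_Cons2: "path_weight H (a # b # p) = wt H (a, b) + path_weight H (b # p)"
  by (simp add: path_weight_def)

lemma path_weight_snoc:
  "p \<noteq> [] \<Longrightarrow> path_weight H (p @ [b]) = path_weight H p + wt H (last p, b)"
proof (induction p)
  case (Cons a p)
  then show ?case by (cases p) (auto simp: path_weight_def)
qed simp

lemma unit_steps_along_dpath:
  assumes "functional_heap H" "dpath H u p v"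
  shows "(unit_step H ^^ path_weight H p) (u, 0) (v, 0)"
  using assms(2)
proof (induction p arbitrary: u)
  case (Cons a p)
  show ?case
  proof (cases p)
    case Nil
    then show ?thesis using Cons.prems by (auto simp: dpath_def path_weight_def)
  next
    case (Cons b p')
    have ab: "u = a" "(a, b) \<in> edges H" "dpath H b p v"
      using Cons.prems Cons by (auto simp: dpath_def)
    have "(unit_step H ^^ (wt H (a, b) + path_weight H p)) (a, 0) (v, 0)"
      unfolding relpowp_add
      using unit_steps_along_edge[OF assms(1) ab(2)] Cons.IH[OF ab(3)] by auto
    then show ?thesis using Cons ab by (simp add: path_weight_Cons2)
  qed
qed (simp add: dpath_def)

text \<open>A run may stop inside an edge. Counting the offset \<open>snd t\<close> on top of the
  weight of the completed edges is what lets the induction go through.\<close>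

lemma dpath_if_unit_steps:
  assumes "(unit_step H ^^ n) (u, 0) t"
  shows "\<exists>p. dpath H u p (fst t) \<and> path_weight H p + snd t = n"
  using assms
proof (induction n arbitrary: t)
  case 0
  then have "dpath H u [u] (fst t) \<and> path_weight H [u] + snd t = 0"
    by (auto simp: dpath_def path_weight_def)
  then show ?case by blast
next
  case (Suc n)
  then obtain s where s: "(unit_step H ^^ n) (u, 0) s" "unit_step H s t" by auto
  then obtain p where p: "dpath H u p (fst s)" "path_weight H p + snd s = n"
    using Suc.IH by blast
  from s(2) obtain w where w: "(fst s, w) \<in> edges H"
    "Suc (snd s) < wt H (fst s, w) \<and> t = (fst s, Suc (snd s)) \<or>
     Suc (snd s) = wt H (fst s, w) \<and> t = (w, 0)"
    by (auto simp: unit_step_def)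
  from w(2) show ?case
  proof
    assume "Suc (snd s) < wt H (fst s, w) \<and> t = (fst s, Suc (snd s))"
    then show ?thesis using p by auto
  next
    assume t: "Suc (snd s) = wt H (fst s, w) \<and> t = (w, 0)"
    have "dpath H u (p @ [w]) w"
      using p(1) w(1) by (auto simp: dpath_def successively_append_iff)
    moreover have "path_weight H (p @ [w]) = Suc n"
      using p t path_weight_snoc[of p H w] by (auto simp: dpath_def)
    ultimately show ?thesis using t by auto
  qed
qed

text \<open>Between positions of offset 0, lengths of unit runs and weights of paths form the same
  set, so the infima agree without any argument about minimal paths.\<close>

lemma path_length_eq_unit_steps:
  assumes "functional_heap H"
  shows "path_length H x y = Inf {enat n | n. (unit_step H ^^ n) (lab H x, 0) (lab H y, 0)}"
proof -
  have "{enat (path_weight H p) | p. dpath H (lab H x) p (lab H y)} =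
      {enat n | n. (unit_step H ^^ n) (lab H x, 0) (lab H y, 0)}"
    using unit_steps_along_dpath[OF assms] dpath_if_unit_steps by fastforce
  then show ?thesis by (simp add: path_length_def)
qed

lemma circular_iff_unit_steps:
  assumes "functional_heap H"
  shows "circular H x \<longleftrightarrow> (\<exists>n>0. (unit_step H ^^ n) (lab H x, 0) (lab H x, 0))"
proof
  have "\<exists>n>0. (unit_step H ^^ n) (u, 0) (v, 0)" if "(u, v) \<in> (edges H)\<^sup>+" for u v
    using that
  proof (induction rule: trancl.induct)
    case (r_into_trancl a b)
    then show ?case using unit_steps_along_edge[OF assms] functional_heapD(4)[OF assms] by blast
  next
    case (trancl_into_trancl a b c)
    then obtain n where n: "n > 0" "(unit_step H ^^ n) (a, 0) (b, 0)" by blast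
    have "(unit_step H ^^ (n + wt H (b, c))) (a, 0) (c, 0)"
      unfolding relpowp_add using n unit_steps_along_edge[OF assms trancl_into_trancl(2)] by auto
    then show ?case using n(1) by (meson trans_less_add1)
  qed
  then show "circular H x \<Longrightarrow> \<exists>n>0. (unit_step H ^^ n) (lab H x, 0) (lab H x, 0)"
    by (auto simp: circular_def)
next
  assume "\<exists>n>0. (unit_step H ^^ n) (lab H x, 0) (lab H x, 0)"
  then obtain p where p: "dpath H (lab H x) p (lab H x)" "path_weight H p > 0"
    using dpath_if_unit_steps by fastforce
  have "dpath H u p v \<Longrightarrow> length p > 1 \<Longrightarrow> (u, v) \<in> (edges H)\<^sup>+" for u v
  proof (induction p arbitrary: u)
    case (Cons a p)
    then obtain b p' where b: "p = b # p'" by (cases p) auto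
    then have ab: "u = a" "(a, b) \<in> edges H" "dpath H b p v"
      using Cons.prems by (auto simp: dpath_def)
    show ?case
    proof (cases "p' = []")
      case True
      then show ?thesis using ab b by (auto simp: dpath_def)
    next
      case False
      then show ?thesis using ab b Cons.IH[of b] by (auto intro: trancl_into_trancl2)
    qed
  qed simp
  \<comment> \<open>A one-vertex path has weight 0, so positive weight guarantees at least one
    edge.\<close>
  moreover have "length p > 1"
    using p by (cases p; cases "tl p") (auto simp: path_weight_def)
  ultimately show "circular H x" using p by (auto simp: circular_def)
qed

section \<open>Subdivision as a renaming of positions\<close>

lemma functional_heap_subdivide:
  assumes "functional_heap H" "(u, v) \<in> edges H" "q \<notin> verts H" "0 < k" "0 < l"
  shows "functional_heap (subdivide u v q k l H)"
  using assms(2-5) functional_heapD[OF assms(1)]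
  by (intro functional_heapI) (auto simp: subdivide_def)

lemma unit_bisimilar_subdivide:
  assumes H: "functional_heap H" and uv: "(u, v) \<in> edges H" and q: "q \<notin> verts H"
    and kl: "0 < k" "0 < l" "k + l = wt H (u, v)"
  shows "unit_bisimilar H (subdivide u v q k l H)"
proof -
  let ?K = "subdivide u v q k l H"
  \<comment> \<open>The point at distance \<open>k\<close> on the edge becomes the vertex
    \<open>q\<close>, and later points are measured from there.\<close>
  define \<phi> where "\<phi> s = (if fst s = u \<and> k \<le> snd s then (q, snd s - k) else s)" for s :: "'b \<times> nat"
  define R where "R s s' \<longleftrightarrow> fst s \<in> verts H \<and> s' = \<phi> s" for s s'
  note fh = functional_heapD[OF H]
  have uq: "u \<noteq> q" "v \<noteq> q" using fh(2,3) uv q by blast+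
  have fw: "unit_sim R H ?K"
  proof (rule unit_simI)
    show "R (lab H p, 0) (lab ?K p, 0)" for p
      using fh(5) kl by (auto simp: R_def \<phi>_def subdivide_def)
  next
    fix s s' t
    assume R: "R s s'" and st: "unit_step H s t"
    from st obtain w where w: "(fst s, w) \<in> edges H"
      "Suc (snd s) < wt H (fst s, w) \<and> t = (fst s, Suc (snd s)) \<or>
       Suc (snd s) = wt H (fst s, w) \<and> t = (w, 0)" by (auto simp: unit_step_def)
    have sv: "fst s \<noteq> q" "w \<noteq> q" "w \<in> verts H" using fh(2,3) w q by blast+
    have "unit_step ?K s' (\<phi> t)"
    proof (cases "fst s = u")
      case True
      then have "w = v" using w uv fh(6) by blast
      \<comment> \<open>The cases are a step that stays before \<open>q\<close>, the step that
        arrives at \<open>q\<close>, and a step on the second piece.\<close>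
      then show ?thesis using True w R uq kl
        by (cases "k \<le> snd s"; cases "Suc (snd s) = k")
           (auto simp: R_def \<phi>_def unit_step_def subdivide_def)
    next
      case False
      then show ?thesis using w R sv kl by (auto simp: R_def \<phi>_def unit_step_def subdivide_def)
    qed
    moreover have "R t (\<phi> t)" using w sv R by (auto simp: R_def)
    ultimately show "\<exists>t'. unit_step ?K s' t' \<and> R t t'" by blast
  qed (auto simp: R_def)
  have "unit_sim R\<inverse>\<inverse> ?K H"
  proof (rule unit_simI)
    show "R\<inverse>\<inverse> (lab ?K p, 0) (lab H p, 0)" for p
      using fh(5) kl by (auto simp: R_def \<phi>_def subdivide_def)
  next
    fix s s' assume "R\<inverse>\<inverse> s s'"
    then show "fst s \<in> verts ?K" by (auto simp: R_def \<phi>_def subdivide_def)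
  next
    \<comment> \<open>The renaming is injective on positions of \<open>H\<close> because the fresh
      \<open>q\<close> carries none of them.\<close>
    fix s s' t' assume "R\<inverse>\<inverse> s s'" "R\<inverse>\<inverse> s t'"
    then show "s' = t'" using q by (auto simp: R_def \<phi>_def prod_eq_iff split: if_splits)
  next
    fix s s' t
    assume R: "R\<inverse>\<inverse> s s'" and st: "unit_step ?K s t"
    have s': "fst s' \<in> verts H" "fst s' \<noteq> q" "s = \<phi> s'" using R q by (auto simp: R_def)
    have qe: "(q, w) \<notin> edges H" "(w, q) \<notin> edges H" for w using fh(2,3) q by blast+
    have "\<exists>t'. unit_step H s' t' \<and> t = \<phi> t'"
    proof (cases "fst s' = u")
      case True
      have uw: "(u, w) \<in> edges H \<longleftrightarrow> w = v" for w using uv fh(6) by blast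
      show ?thesis
      proof (cases "Suc (snd s') < wt H (u, v)")
        case less: True
        then have "unit_step H s' (u, Suc (snd s'))" using True uv by (auto simp: unit_step_def)
        moreover have "t = \<phi> (u, Suc (snd s'))"
          using st True s' uq kl less qe uw
          by (auto simp: \<phi>_def unit_step_def subdivide_def split: if_splits)
        ultimately show ?thesis by blast
      next
        case False
        \<comment> \<open>\<open>R\<close> also relates offsets at or beyond the weight. These are
          stuck in the subdivided heap, so the existence of the step \<open>st\<close> leaves only
          the last offset on the edge.\<close>
        then have "Suc (snd s') = wt H (u, v) \<and> t = \<phi> (v, 0)"
          using st True s' uq kl qe uw
          by (auto simp: \<phi>_def unit_step_def subdivide_def split: if_splits)
        then show ?thesis using True uv by (auto simp: unit_step_def)
      qed
    next
      case False
      then have "unit_step H s' t" "t = \<phi> t"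
        using st s' qe kl by (auto simp: \<phi>_def unit_step_def subdivide_def split: if_splits)
      then show ?thesis by blast
    qed
    then obtain t' where t': "unit_step H s' t'" "t = \<phi> t'" by blast
    then have "fst t' \<in> verts H" using s' fh(3) by (auto simp: unit_step_def)
    then show "\<exists>t'. unit_step H s' t' \<and> R\<inverse>\<inverse> t t'" using t' by (metis R_def conversepI)
  qed
  then show ?thesis using fw unfolding unit_bisimilar_def by blast
qed

lemma unit_bisimilar_refl:
  assumes "functional_heap H"
  shows "unit_bisimilar H H"
proof -
  let ?R = "\<lambda>s s'. fst s \<in> verts H \<and> s' = (s :: 'b \<times> nat)"
  have sim: "unit_sim ?R H H"
    using functional_heapD[OF assms] by (intro unit_simI) (auto simp: unit_step_def)
  have "?R\<inverse>\<inverse> = ?R" by (auto simp: fun_eq_iff)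
  then have "unit_sim ?R\<inverse>\<inverse> H H" using sim by simp
  then show ?thesis unfolding unit_bisimilar_def using sim by blast
qed

lemma subdivision_imp_unit_bisimilar:
  assumes "subdivision H K" "functional_heap H"
  shows "functional_heap K \<and> unit_bisimilar H K"
  using assms(1) unfolding subdivision_def
proof (induction rule: rtranclp_induct)
  case base
  then show ?case using assms(2) unit_bisimilar_refl by blast
next
  case (step K L)
  then obtain u v q k l where e: "(u, v) \<in> edges K" "q \<notin> verts K" "0 < k" "0 < l"
    "k + l = wt K (u, v)" and L: "L = subdivide u v q k l K"
    unfolding subdivision_step_def by blast
  then show ?case
    using functional_heap_subdivide[OF _ e(1-4)] unit_bisimilar_subdivide[OF _ e] step.IH
      unit_bisimilar_trans by blast
qed

section \<open>Isomorphism of reachable sub-heaps and bisimilarity\<close>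

abbreviation reachable_verts :: "('p, 'v) heap \<Rightarrow> 'v set" where
  "reachable_verts H \<equiv> verts (reachable_subheap H)"

lemma reachable_subheap_simps:
  "lab (reachable_subheap H) = lab H"
  "edges (reachable_subheap H) = edges H \<inter> reachable_verts H \<times> reachable_verts H"
  "wt (reachable_subheap H) = wt H"
  by (auto simp: reachable_subheap_def Let_def)

lemma reachable_verts_subset: "reachable_verts H \<subseteq> verts H"
  by (auto simp: reachable_subheap_def Let_def)

lemma reachable_verts_lab: "functional_heap H \<Longrightarrow> lab H p \<in> reachable_verts H"
  by (auto simp: reachable_subheap_def Let_def functional_heapD)

lemma reachable_verts_step:
  "functional_heap H \<Longrightarrow> u \<in> reachable_verts H \<Longrightarrow> (u, v) \<in> edges H \<Longrightarrow> v \<in> reachable_verts H"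
  by (auto simp: reachable_subheap_def Let_def functional_heapD intro: rtrancl_into_rtrancl)

lemma reachable_verts_induct:
  assumes "v \<in> reachable_verts H"
    and "\<And>p. P (lab H p)"
    and "\<And>u v. P u \<Longrightarrow> (u, v) \<in> edges H \<Longrightarrow> P v"
  shows "P v"
proof -
  obtain p where "(lab H p, v) \<in> (edges H)\<^sup>*"
    using assms(1) by (auto simp: reachable_subheap_def Let_def)
  then show ?thesis by (induction rule: rtrancl_induct) (use assms(2,3) in auto)
qed

text \<open>An isomorphism preserves weights, so it acts on positions by moving the vertex and
  keeping the offset. It is controlled on reachable vertices only, which suffices because these
  contain the labels and are closed under edges.\<close>

lemma isomorphic_imp_unit_bisimilar:
  assumes "functional_heap H" "functional_heap H'" "isomorphic H H'"
  shows "unit_bisimilar H H'"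
proof -
  obtain f where bij: "bij_betw f (reachable_verts H) (reachable_verts H')"
    and ed: "\<And>u v. u \<in> reachable_verts H \<Longrightarrow> v \<in> reachable_verts H \<Longrightarrow>
      (u, v) \<in> edges H \<longleftrightarrow> (f u, f v) \<in> edges H'"
    and wt: "\<And>u v. u \<in> reachable_verts H \<Longrightarrow> v \<in> reachable_verts H \<Longrightarrow> (u, v) \<in> edges H \<Longrightarrow>
      wt H' (f u, f v) = wt H (u, v)"
    and lab: "\<And>p. f (lab H p) = lab H' p"
  proof -
    obtain f where f: "heap_iso_map f (reachable_subheap H) (reachable_subheap H')"
      using assms(3) by (auto simp: isomorphic_def)
    \<comment> \<open>As \<open>f\<close> stays within reachable vertices, restricting the edges to
      them makes no difference, and the conditions on \<open>f\<close> can be stated for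
      \<open>H\<close> and \<open>H'\<close> themselves.\<close>
    then have "f v \<in> reachable_verts H'" if "v \<in> reachable_verts H" for v
      using that by (auto simp: heap_iso_map_def bij_betw_def)
    then show ?thesis
      using f by (intro that[of f]) (fastforce simp: heap_iso_map_def reachable_subheap_simps)+
  qed
  define R where "R s s' \<longleftrightarrow> fst s \<in> reachable_verts H \<and> s' = (f (fst s), snd s)"
    for s s' :: "'b \<times> nat"
  note step = reachable_verts_step[OF assms(1)] reachable_verts_step[OF assms(2)]
  have fR: "f v \<in> reachable_verts H'" if "v \<in> reachable_verts H" for v
    using that bij by (auto simp: bij_betw_def)
  have "unit_sim R H H'"
  proof (rule unit_simI)
    fix s s' t
    assume R: "R s s'" and st: "unit_step H s t"
    from st obtain w where w: "(fst s, w) \<in> edges H"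
      "Suc (snd s) < wt H (fst s, w) \<and> t = (fst s, Suc (snd s)) \<or>
       Suc (snd s) = wt H (fst s, w) \<and> t = (w, 0)" by (auto simp: unit_step_def)
    have s: "fst s \<in> reachable_verts H" "s' = (f (fst s), snd s)" using R by (auto simp: R_def)
    have wr: "w \<in> reachable_verts H" using step(1) s(1) w(1) by blast
    have "(f (fst s), f w) \<in> edges H'" "wt H' (f (fst s), f w) = wt H (fst s, w)"
      using ed wt s(1) wr w(1) by auto
    then have "unit_step H' s' (f (fst t), snd t) \<and> R t (f (fst t), snd t)"
      using w s wr by (auto simp: unit_step_def R_def)
    then show "\<exists>t'. unit_step H' s' t' \<and> R t t'" by blast
  qed (use lab reachable_verts_lab[OF assms(1)] reachable_verts_subset[of H] in
      \<open>auto simp: R_def\<close>)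
  moreover have "unit_sim R\<inverse>\<inverse> H' H"
  proof (rule unit_simI)
    fix s s' t
    assume R: "R\<inverse>\<inverse> s s'" and st: "unit_step H' s t"
    from st obtain w where w: "(fst s, w) \<in> edges H'"
      "Suc (snd s) < wt H' (fst s, w) \<and> t = (fst s, Suc (snd s)) \<or>
       Suc (snd s) = wt H' (fst s, w) \<and> t = (w, 0)" by (auto simp: unit_step_def)
    have s: "fst s' \<in> reachable_verts H" "s = (f (fst s'), snd s')" using R by (auto simp: R_def)
    then have "w \<in> reachable_verts H'" using step(2) fR w(1) by auto
    then obtain z where z: "z \<in> reachable_verts H" "w = f z" using bij by (auto simp: bij_betw_def)
    have "(fst s', z) \<in> edges H" "wt H' (fst s, w) = wt H (fst s', z)"
      using ed wt s z w(1) by auto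
    then show "\<exists>t'. unit_step H s' t' \<and> R\<inverse>\<inverse> t t'"
      using w s z by (fastforce simp: unit_step_def R_def)
  next
    fix s s' t' assume "R\<inverse>\<inverse> s s'" "R\<inverse>\<inverse> s t'"
    then show "s' = t'" using bij by (auto simp: R_def prod_eq_iff bij_betw_def inj_on_def)
  qed (use lab fR reachable_verts_lab[OF assms(1)] reachable_verts_subset[of H'] in
      \<open>auto simp: R_def\<close>)
  ultimately show ?thesis unfolding unit_bisimilar_def by blast
qed

text \<open>The measure is the total excess of the weights over 1. Splitting off a first piece of
  weight 1 replaces the excess \<open>wt H (u, v) - 1\<close> by one less; the infinite vertex type
  always supplies the fresh vertex.\<close>

lemma ex_unit_weight_subdivision:
  fixes H :: "('p, 'v) heap"
  assumes "infinite (UNIV :: 'v set)" "functional_heap H"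
  shows "\<exists>K. subdivision H K \<and> (\<forall>e\<in>edges K. wt K e = 1)"
  using assms(2)
proof (induction "\<Sum>e\<in>edges H. wt H e - 1" arbitrary: H rule: less_induct)
  case less
  note fh = functional_heapD[OF less.prems]
  show ?case
  proof (cases "\<forall>e\<in>edges H. wt H e = 1")
    case True
    then show ?thesis unfolding subdivision_def by blast
  next
    case False
    then obtain u v where uv: "(u, v) \<in> edges H" "wt H (u, v) \<noteq> 1" by auto
    then have w: "wt H (u, v) > 1" using fh(4) by (metis One_nat_def Suc_lessI)
    obtain q where q: "q \<notin> verts H" using ex_new_if_finite[OF assms(1) fh(1)] by blast
    let ?l = "wt H (u, v) - 1"
    let ?K = "subdivide u v q 1 ?l H"
    have qe: "(q, z) \<notin> edges H" "(z, q) \<notin> edges H" "u \<noteq> q" "v \<noteq> q" for z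
      using fh(2,3) q uv by blast+
    have K: "functional_heap ?K" using functional_heap_subdivide[OF less.prems uv(1) q] w by auto
    have ed: "edges ?K = insert (u, q) (insert (q, v) (edges H - {(u, v)}))"
      by (auto simp: subdivide_def)
    have same: "(\<Sum>e\<in>edges H - {(u, v)}. wt ?K e - 1) = (\<Sum>e\<in>edges H - {(u, v)}. wt H e - 1)"
      by (rule sum.cong) (use qe in \<open>auto simp: subdivide_def\<close>)
    have "(\<Sum>e\<in>edges ?K. wt ?K e - 1) =
        wt ?K (u, q) - 1 + (wt ?K (q, v) - 1 + (\<Sum>e\<in>edges H - {(u, v)}. wt ?K e - 1))"
      unfolding ed using qe fh(7) by (subst sum.insert; simp)+
    also have "\<dots> = ?l - 1 + (\<Sum>e\<in>edges H - {(u, v)}. wt H e - 1)"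
      unfolding same using qe by (auto simp: subdivide_def)
    also have "\<dots> < ?l + (\<Sum>e\<in>edges H - {(u, v)}. wt H e - 1)" using w by simp
    also have "\<dots> = (\<Sum>e\<in>edges H. wt H e - 1)" using sum.remove[OF fh(7) uv(1)] by metis
    finally obtain L where L: "subdivision ?K L" "\<forall>e\<in>edges L. wt L e = 1"
      using less.hyps K by blast
    have "subdivision_step H ?K"
      unfolding subdivision_step_def using uv(1) q w
      by (intro exI[of _ u] exI[of _ v] exI[of _ q] exI[of _ 1] exI[of _ ?l]) auto
    then show ?thesis
      using L unfolding subdivision_def by (meson converse_rtranclp_into_rtranclp)
  qed
qed

lemma unit_step_unit_weight:
  assumes "\<forall>e\<in>edges H. wt H e = 1"
  shows "unit_step H (v, 0) t \<longleftrightarrow> snd t = 0 \<and> (v, fst t) \<in> edges H"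
  using assms by (auto simp: unit_step_def prod_eq_iff)

text \<open>With unit weights, steps from offset 0 are exactly edges, so the bisimulation restricted
  to reachable vertices at offset 0 is already a graph isomorphism; preservation of weights is then
  automatic.\<close>

lemma unit_bisimilar_imp_isomorphic:
  assumes H: "functional_heap H" "\<forall>e\<in>edges H. wt H e = 1"
    and H': "functional_heap H'" "\<forall>e\<in>edges H'. wt H' e = 1"
    and bis: "unit_bisimilar H H'"
  shows "isomorphic H H'"
proof -
  obtain R where R: "unit_sim R H H'" "unit_sim R\<inverse>\<inverse> H' H"
    using bis unfolding unit_bisimilar_def by blast
  \<comment> \<open>\<open>R\<close> could pair a vertex with a stuck position of positive offset,
    but not a reachable one: labels sit at offset 0 and unit-weight steps return to offset 0. The
    claim is needed for \<open>R\<close>, to map into the reachable vertices, and for its converse,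
    to map onto them.\<close>
  have matched: "\<exists>v'\<in>reachable_verts K'. S (v, 0) (v', 0)"
    if S: "unit_sim S K K'" and K': "functional_heap K'"
      and one: "\<forall>e\<in>edges K. wt K e = 1" "\<forall>e\<in>edges K'. wt K' e = 1"
      and v: "v \<in> reachable_verts K" for S :: "'b \<times> nat \<Rightarrow> 'b \<times> nat \<Rightarrow> bool"
      and K K' :: "('a, 'b) heap" and v
    using v
  proof (rule reachable_verts_induct)
    show "\<exists>v'\<in>reachable_verts K'. S (lab K p, 0) (v', 0)" for p
      using unit_simD(1)[OF S] reachable_verts_lab[OF K'] by blast
  next
    fix u v
    assume step: "\<exists>u'\<in>reachable_verts K'. S (u, 0) (u', 0)" "(u, v) \<in> edges K"
    then obtain u' where u': "u' \<in> reachable_verts K'" "S (u, 0) (u', 0)" by blast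
    have "unit_step K (u, 0) (v, 0)" using step one by (simp add: unit_step_unit_weight)
    then obtain t' where "unit_step K' (u', 0) t'" "S (v, 0) t'"
      using unit_simD(4)[OF S u'(2)] by blast
    then show "\<exists>v'\<in>reachable_verts K'. S (v, 0) (v', 0)"
      using one(2) reachable_verts_step[OF K' u'(1)]
      by (metis unit_step_unit_weight prod.collapse)
  qed
  define f where "f v = (THE v'. R (v, 0) (v', 0))" for v
  have f_eq: "f v = v'" if "R (v, 0) (v', 0)" for v v'
    unfolding f_def using that unit_simD(3)[OF R(1)] by blast
  have f: "R (v, 0) (f v, 0) \<and> f v \<in> reachable_verts H'" if "v \<in> reachable_verts H" for v
    using matched[OF R(1) H'(1) H(2) H'(2) that] f_eq by blast
  have inj: "u = v" if "R (u, 0) (w, 0)" "R (v, 0) (w, 0)" for u v w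
    using unit_simD(3)[OF R(2), of "(w, 0)" "(u, 0)" "(v, 0)"] that by simp
  have "inj_on f (reachable_verts H)" using f inj by (metis inj_onI)
  moreover have "f ` reachable_verts H = reachable_verts H'"
    using f f_eq matched[OF R(2) H(1) H'(2) H(2)] by (force simp: image_iff)
  ultimately have bij: "bij_betw f (reachable_verts H) (reachable_verts H')"
    by (simp add: bij_betw_def)
  have ed: "(u, v) \<in> edges H \<longleftrightarrow> (f u, f v) \<in> edges H'"
    if u: "u \<in> reachable_verts H" and v: "v \<in> reachable_verts H" for u v
  proof
    assume "(u, v) \<in> edges H"
    then have "unit_step H (u, 0) (v, 0)" using H(2) by (simp add: unit_step_unit_weight)
    then obtain t' where t': "unit_step H' (f u, 0) t'" "R (v, 0) t'"
      using unit_simD(4)[OF R(1)] f[OF u] by blast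
    then have "t' = (f v, 0)" using unit_simD(3)[OF R(1)] f[OF v] by blast
    then show "(f u, f v) \<in> edges H'" using t'(1) H'(2) by (simp add: unit_step_unit_weight)
  next
    assume "(f u, f v) \<in> edges H'"
    then have "unit_step H' (f u, 0) (f v, 0)" using H'(2) by (simp add: unit_step_unit_weight)
    then obtain t where t: "unit_step H (u, 0) t" "R t (f v, 0)"
      using unit_simD(4)[OF R(2), of "(f u, 0)" "(u, 0)"] f[OF u] by (metis conversep_iff)
    then have "t = (v, 0)"
      using unit_simD(3)[OF R(2), of "(f v, 0)" t "(v, 0)"] f[OF v] by simp
    then show "(u, v) \<in> edges H" using t(1) H(2) by (simp add: unit_step_unit_weight)
  qed
  have "f (lab H p) = lab H' p" for p using f_eq unit_simD(1)[OF R(1)] by blast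
  then have "heap_iso_map f (reachable_subheap H) (reachable_subheap H')"
    using bij ed f H(2) H'(2) by (auto simp: heap_iso_map_def reachable_subheap_simps)
  then show ?thesis unfolding isomorphic_def by blast
qed

lemma homeomorphic_iff_unit_bisimilar:
  fixes H H' :: "('p, 'v) heap"
  assumes "infinite (UNIV :: 'v set)" "functional_heap H" "functional_heap H'"
  shows "H \<sim>\<^sub>h H' \<longleftrightarrow> unit_bisimilar H H'"
proof
  assume "H \<sim>\<^sub>h H'"
  then obtain K K' where "subdivision H K" "subdivision H' K'" "isomorphic K K'"
    unfolding homeomorphic_def by blast
  then show "unit_bisimilar H H'"
    using assms(2,3) subdivision_imp_unit_bisimilar isomorphic_imp_unit_bisimilar
    by (meson unit_bisimilar_sym unit_bisimilar_trans)
next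
  assume bis: "unit_bisimilar H H'"
  obtain K where K: "subdivision H K" "\<forall>e\<in>edges K. wt K e = 1"
    using ex_unit_weight_subdivision assms by blast
  obtain K' where K': "subdivision H' K'" "\<forall>e\<in>edges K'. wt K' e = 1"
    using ex_unit_weight_subdivision assms by blast
  have "functional_heap K" "functional_heap K'" "unit_bisimilar K K'"
    using subdivision_imp_unit_bisimilar K(1) K'(1) assms(2,3) bis
    by (meson unit_bisimilar_sym unit_bisimilar_trans)+
  then have "isomorphic K K'" using unit_bisimilar_imp_isomorphic K(2) K'(2) by blast
  then show "H \<sim>\<^sub>h H'" using K(1) K'(1) unfolding homeomorphic_def by blast
qed

section \<open>Transformers: applicability, assignment and allocation\<close>

text \<open>Applicability of a transformer is assumed for one heap only; this transfers the required
  successor to the other.\<close>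

lemma unit_bisimilar_edge_from_lab:
  assumes "functional_heap H" "unit_bisimilar H H'" "(lab H x, u) \<in> edges H"
  shows "\<exists>u'. (lab H' x, u') \<in> edges H'"
proof -
  obtain R where R: "unit_sim R H H'" using assms(2) unfolding unit_bisimilar_def by blast
  obtain k where "wt H (lab H x, u) = Suc k"
    using functional_heapD(4)[OF assms(1,3)] gr0_implies_Suc by blast
  \<comment> \<open>Where the first unit step lands depends on whether the edge has weight
    1.\<close>
  then have "unit_step H (lab H x, 0) (if k = 0 then (u, 0) else (lab H x, 1))"
    using assms(3) by (auto simp: unit_step_def)
  then obtain t' where "unit_step H' (lab H' x, 0) t'"
    using unit_simD(4)[OF R unit_simD(1)[OF R]] by blast
  then show ?thesis by (auto simp: unit_step_def)
qed

lemma unit_step_update_lab [simp]: "unit_step (H\<lparr>lab := L\<rparr>) = unit_step H"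
  by (simp add: unit_step_def fun_eq_iff)

lemma functional_heap_update_lab:
  "functional_heap H \<Longrightarrow> v \<in> verts H \<Longrightarrow> functional_heap (H\<lparr>lab := (lab H)(x := v)\<rparr>)"
  using functional_heapD[of H] by (intro functional_heapI) auto

lemma unit_sim_update_lab:
  assumes "unit_sim R H H'" "R (v, 0) (v', 0)"
  shows "unit_sim R (H\<lparr>lab := (lab H)(x := v)\<rparr>) (H'\<lparr>lab := (lab H')(x := v')\<rparr>)"
  using assms unfolding unit_sim_def by simp

lemma assign_heap_unit_bisimilar:
  assumes "unit_bisimilar H H'"
  shows "unit_bisimilar (assign_heap x y H) (assign_heap x y H')"
proof -
  obtain R where R: "unit_sim R H H'" "unit_sim R\<inverse>\<inverse> H' H"
    using assms unfolding unit_bisimilar_def by blast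
  then show ?thesis
    using unit_sim_update_lab[OF R(1) unit_simD(1)[OF R(1)]]
      unit_sim_update_lab[OF R(2) unit_simD(1)[OF R(2)]]
    unfolding unit_bisimilar_def assign_heap_def by blast
qed

lemma functional_heap_assign_heap:
  "functional_heap H \<Longrightarrow> functional_heap (assign_heap x y H)"
  unfolding assign_heap_def by (simp add: functional_heap_update_lab functional_heapD(5))

lemma functional_heap_new_heap:
  assumes "functional_heap H" "q \<notin> verts H"
  shows "functional_heap (new_heap nl q x H)"
  using assms(2) functional_heapD[OF assms(1)]
  by (intro functional_heapI) (auto simp: new_heap_def)

text \<open>Related positions lie over old vertices, so the pair of fresh positions can be added
  without a clash, and old positions keep their steps. From a fresh position the only step leads to
  the null label, and null labels are already related.\<close>

lemma unit_sim_new_heap: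
  assumes S: "unit_sim R H H'" "unit_sim R\<inverse>\<inverse> H' H"
    and H: "functional_heap H" "q \<notin> verts H" and H': "functional_heap H'" "q' \<notin> verts H'"
  shows "unit_sim (\<lambda>s s'. R s s' \<or> s = (q, 0) \<and> s' = (q', 0))
    (new_heap nl q x H) (new_heap nl q' x H')"
proof -
  have old: "unit_step (new_heap nl r x K) s t \<longleftrightarrow> unit_step K s t" if "r \<noteq> fst s"
    for r K s t
    using that by (auto simp: unit_step_def new_heap_def)
  have qe: "(q, w) \<notin> edges H" for w using functional_heapD(2)[OF H(1)] H(2) by blast
  have R: "fst s \<noteq> q" "fst s' \<noteq> q'" if "R s s'" for s s'
    using unit_simD(2)[OF S(1)] unit_simD(2)[OF S(2)] that H(2) H'(2) by fastforce+
  show ?thesis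
  proof (rule unit_simI)
    fix s s' t
    assume "R s s' \<or> s = (q, 0) \<and> s' = (q', 0)" and st: "unit_step (new_heap nl q x H) s t"
    then consider "R s s'" | "s = (q, 0)" "s' = (q', 0)" by blast
    then show "\<exists>t'. unit_step (new_heap nl q' x H') s' t' \<and> (R t t' \<or> t = (q, 0) \<and> t' = (q', 0))"
    proof cases
      case 1
      then show ?thesis using st old R[OF 1] unit_simD(4)[OF S(1) 1] by metis
    next
      case 2
      then have "t = (lab H nl, 0)" using st qe by (auto simp: unit_step_def new_heap_def)
      moreover have "unit_step (new_heap nl q' x H') s' (lab H' nl, 0)"
        using 2 by (auto simp: unit_step_def new_heap_def)
      ultimately show ?thesis using unit_simD(1)[OF S(1)] by blast
    qed
  next
    fix s s' t'
    assume "R s s' \<or> s = (q, 0) \<and> s' = (q', 0)" "R s t' \<or> s = (q, 0) \<and> t' = (q', 0)"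
    then show "s' = t'" using R(1) unit_simD(3)[OF S(1)] by fastforce
  qed (use unit_simD(1,2)[OF S(1)] in \<open>auto simp: new_heap_def\<close>)
qed

lemma new_heap_unit_bisimilar:
  assumes "functional_heap H" "q \<notin> verts H" "functional_heap H'" "q' \<notin> verts H'"
    and "unit_bisimilar H H'"
  shows "unit_bisimilar (new_heap nl q x H) (new_heap nl q' x H')"
proof -
  obtain R where R: "unit_sim R H H'" "unit_sim R\<inverse>\<inverse> H' H"
    using assms(5) unfolding unit_bisimilar_def by blast
  let ?R = "\<lambda>s s'. R s s' \<or> s = (q, 0) \<and> s' = (q', 0)"
  \<comment> \<open>The extended relation is symmetric in the two heaps, so the one-directional
    lemma, applied to the converse of \<open>R\<close>, yields the other direction.\<close>
  have "(\<lambda>s s'. R\<inverse>\<inverse> s s' \<or> s = (q', 0) \<and> s' = (q, 0)) = ?R\<inverse>\<inverse>" by (auto simp: fun_eq_iff)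
  then have "unit_sim ?R\<inverse>\<inverse> (new_heap nl q' x H') (new_heap nl q x H)"
    using unit_sim_new_heap[of "R\<inverse>\<inverse>" H' H q' q nl x] R assms by simp
  then show ?thesis
    using unit_sim_new_heap[OF R assms(1-4)] unfolding unit_bisimilar_def by blast
qed

section \<open>Transformers: update\<close>

text \<open>Since a vertex has at most one outgoing edge, deleting the edge to the successor deletes
  everything that leaves \<open>lab H x\<close>.\<close>

lemma edges_update_heap:
  assumes "functional_heap H" "(lab H x, u) \<in> edges H"
  shows "edges (update_heap x y H) = insert (lab H x, lab H y) {e \<in> edges H. fst e \<noteq> lab H x}"
  using functional_heapD(6)[OF assms(1)] succ_eq[OF assms] assms(2)
  by (auto simp: update_heap_def)

lemma functional_heap_update_heap:
  assumes "functional_heap H" "(lab H x, u) \<in> edges H"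
  shows "functional_heap (update_heap x y H)"
  using functional_heapD[OF assms(1)]
  by (intro functional_heapI) (auto simp: edges_update_heap[OF assms], auto simp: update_heap_def)

lemma unit_step_update_heap:
  assumes "functional_heap H" "(lab H x, u) \<in> edges H"
  shows "fst s \<noteq> lab H x \<Longrightarrow> unit_step (update_heap x y H) s t \<longleftrightarrow> unit_step H s t"
    and "unit_step (update_heap x y H) (lab H x, 0) t \<longleftrightarrow> t = (lab H y, 0)"
  by (auto simp: unit_step_def edges_update_heap[OF assms]) (auto simp: update_heap_def)

text \<open>
  The interior of the edge leaving \<open>L(x)\<close> is dropped from the bisimulation: it can only be entered
  from \<open>L(x)\<close>, so it is cut off by the update.
\<close>

definition avoid_interior :: "'v \<Rightarrow> 'v \<times> nat \<Rightarrow> bool" where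
  "avoid_interior a s \<longleftrightarrow> (fst s = a \<longrightarrow> snd s = 0)"

text \<open>Without the restriction the relation would fail: an interior position of the old edge is
  stuck once the new edge has weight 1, while its partner may lie over a subdividing vertex of the
  other heap and still move.\<close>

lemma unit_sim_update_heap:
  assumes S: "unit_sim R H H'" "unit_sim R\<inverse>\<inverse> H' H"
    and H: "functional_heap H" "(lab H x, u) \<in> edges H"
    and H': "functional_heap H'" "(lab H' x, u') \<in> edges H'"
  shows "unit_sim (\<lambda>s s'. R s s' \<and> avoid_interior (lab H x) s \<and> avoid_interior (lab H' x) s')
    (update_heap x y H) (update_heap x y H')"
proof (rule unit_simI)
  fix s s' t
  assume R: "R s s' \<and> avoid_interior (lab H x) s \<and> avoid_interior (lab H' x) s'"
    and st: "unit_step (update_heap x y H) s t"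
  \<comment> \<open>Both heaps change behaviour at the same related pair: on the restricted
    relation, lying over the label \<open>x\<close> means being its position at offset 0, which has
    a unique partner.\<close>
  have iff: "fst s = lab H x \<longleftrightarrow> fst s' = lab H' x"
  proof
    assume "fst s = lab H x"
    then have "s = (lab H x, 0)" using R by (simp add: avoid_interior_def prod_eq_iff)
    then show "fst s' = lab H' x"
      using R unit_simD(3)[OF S(1)] unit_simD(1)[OF S(1)] by (metis fst_conv)
  next
    assume "fst s' = lab H' x"
    then have "s' = (lab H' x, 0)" using R by (simp add: avoid_interior_def prod_eq_iff)
    then show "fst s = lab H x"
      using R unit_simD(3)[OF S(2)] unit_simD(1)[OF S(2)] by (metis fst_conv conversepI)
  qed
  show "\<exists>t'. unit_step (update_heap x y H') s' t' \<and>
      R t t' \<and> avoid_interior (lab H x) t \<and> avoid_interior (lab H' x) t'"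
  proof (cases "fst s = lab H x")
    case True
    then have "s = (lab H x, 0)" "s' = (lab H' x, 0)"
      using R iff by (simp_all add: avoid_interior_def prod_eq_iff)
    then show ?thesis
      using st unit_step_update_heap(2)[OF H] unit_step_update_heap(2)[OF H'] unit_simD(1)[OF S(1)]
      by (auto simp: avoid_interior_def)
  next
    case False
    then have st': "unit_step H s t" using st unit_step_update_heap(1)[OF H] by blast
    then obtain t' where t': "unit_step H' s' t'" "R t t'" using unit_simD(4)[OF S(1)] R by blast
    moreover have "unit_step (update_heap x y H') s' t'"
      using t'(1) False iff unit_step_update_heap(1)[OF H'] by blast
    \<comment> \<open>A unit step either keeps its vertex or lands at offset 0, so it never enters
      the interior of an edge that leaves another vertex.\<close>
    moreover have "avoid_interior (lab H x) t" "avoid_interior (lab H' x) t'"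
      using st' t'(1) False iff by (auto simp: avoid_interior_def unit_step_def)
    ultimately show ?thesis by blast
  qed
next
  fix p
  show "R (lab (update_heap x y H) p, 0) (lab (update_heap x y H') p, 0) \<and>
    avoid_interior (lab H x) (lab (update_heap x y H) p, 0) \<and>
    avoid_interior (lab H' x) (lab (update_heap x y H') p, 0)"
    using unit_simD(1)[OF S(1)] by (simp add: avoid_interior_def update_heap_def)
qed (use unit_simD(2,3)[OF S(1)] in \<open>auto simp: update_heap_def\<close>)

lemma update_heap_unit_bisimilar:
  assumes "functional_heap H" "(lab H x, u) \<in> edges H"
    and "functional_heap H'" "(lab H' x, u') \<in> edges H'"
    and "unit_bisimilar H H'"
  shows "unit_bisimilar (update_heap x y H) (update_heap x y H')"
proof -
  obtain R where R: "unit_sim R H H'" "unit_sim R\<inverse>\<inverse> H' H"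
    using assms(5) unfolding unit_bisimilar_def by blast
  let ?R = "\<lambda>s s'. R s s' \<and> avoid_interior (lab H x) s \<and> avoid_interior (lab H' x) s'"
  have "(\<lambda>s s'. R\<inverse>\<inverse> s s' \<and> avoid_interior (lab H' x) s \<and> avoid_interior (lab H x) s') = ?R\<inverse>\<inverse>"
    by (auto simp: fun_eq_iff)
  then have "unit_sim ?R\<inverse>\<inverse> (update_heap x y H') (update_heap x y H)"
    using unit_sim_update_heap[of "R\<inverse>\<inverse>" H' H x u' u y] R assms by simp
  then show ?thesis
    using unit_sim_update_heap[OF R assms(1-4)] unfolding unit_bisimilar_def by blast
qed

section \<open>Transformers: lookup\<close>

text \<open>This reduces lookup to subdivision and relabelling: after at most one subdivision, which
  preserves bisimilarity, both branches move \<open>x\<close> to the end of an edge of weight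
  1.\<close>

lemma lookup_heap_eq_relabel:
  assumes "functional_heap H" "(lab H y, u) \<in> edges H" "q \<notin> verts H"
  shows "\<exists>K v. functional_heap K \<and> unit_bisimilar H K \<and> (lab K y, v) \<in> edges K \<and>
    wt K (lab K y, v) = 1 \<and> lookup_heap q x y H = K\<lparr>lab := (lab K)(x := v)\<rparr>"
proof (cases "wt H (lab H y, u) = 1")
  case True
  then have "lookup_heap q x y H = H\<lparr>lab := (lab H)(x := u)\<rparr>"
    by (simp add: lookup_heap_def succ_eq[OF assms(1,2)])
  then show ?thesis using True assms(1,2) unit_bisimilar_refl by blast
next
  case False
  let ?l = "wt H (lab H y, u) - 1"
  let ?K = "subdivide (lab H y) u q 1 ?l H"
  have w: "wt H (lab H y, u) > 1"
    using False functional_heapD(4)[OF assms(1,2)] by linarith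
  have "lab H y \<noteq> q" using functional_heapD(5)[OF assms(1)] assms(3) by blast
  then have "lookup_heap q x y H = ?K\<lparr>lab := (lab ?K)(x := q)\<rparr>"
    "(lab ?K y, q) \<in> edges ?K" "wt ?K (lab ?K y, q) = 1"
    using False by (auto simp: lookup_heap_def Let_def succ_eq[OF assms(1,2)] subdivide_def)
  moreover have "functional_heap ?K" "unit_bisimilar H ?K"
    using functional_heap_subdivide[OF assms] unit_bisimilar_subdivide[OF assms] w by simp_all
  ultimately show ?thesis by blast
qed

lemma functional_heap_lookup_heap:
  assumes "functional_heap H" "(lab H y, u) \<in> edges H" "q \<notin> verts H"
  shows "functional_heap (lookup_heap q x y H)"
proof -
  obtain K v where K: "functional_heap K" "(lab K y, v) \<in> edges K"
    "lookup_heap q x y H = K\<lparr>lab := (lab K)(x := v)\<rparr>"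
    using lookup_heap_eq_relabel[OF assms] by blast
  then show ?thesis using functional_heap_update_lab[OF K(1) functional_heapD(3)[OF K(1,2)]] by simp
qed

lemma lookup_heap_unit_bisimilar:
  assumes "functional_heap H" "(lab H y, u) \<in> edges H" "q \<notin> verts H"
    and "functional_heap H'" "(lab H' y, u') \<in> edges H'" "q' \<notin> verts H'"
    and "unit_bisimilar H H'"
  shows "unit_bisimilar (lookup_heap q x y H) (lookup_heap q' x y H')"
proof -
  obtain K v where K: "functional_heap K" "unit_bisimilar H K" "(lab K y, v) \<in> edges K"
    "wt K (lab K y, v) = 1" "lookup_heap q x y H = K\<lparr>lab := (lab K)(x := v)\<rparr>"
    using lookup_heap_eq_relabel[OF assms(1-3)] by blast
  obtain K' v' where K': "functional_heap K'" "unit_bisimilar H' K'" "(lab K' y, v') \<in> edges K'"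
    "wt K' (lab K' y, v') = 1" "lookup_heap q' x y H' = K'\<lparr>lab := (lab K')(x := v')\<rparr>"
    using lookup_heap_eq_relabel[OF assms(4-6)] by blast
  have "unit_bisimilar K K'"
    using K(2) K'(2) assms(7) unit_bisimilar_sym unit_bisimilar_trans by blast
  then obtain R where R: "unit_sim R K K'" "unit_sim R\<inverse>\<inverse> K' K"
    unfolding unit_bisimilar_def by blast
  \<comment> \<open>The new target is one unit step after the label \<open>y\<close> in both heaps.
    As the edge in \<open>K'\<close> is unique and has weight 1, the matching step must end at
    \<open>(v', 0)\<close>, so the two new labels are related.\<close>
  have "unit_step K (lab K y, 0) (v, 0)" using K(3,4) by (auto simp: unit_step_def)
  then obtain t' where t': "unit_step K' (lab K' y, 0) t'" "R (v, 0) t'"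
    using unit_simD(4)[OF R(1) unit_simD(1)[OF R(1)]] by blast
  then have "t' = (v', 0)"
    using K'(3,4) functional_heapD(6)[OF K'(1)] by (fastforce simp: unit_step_def)
  then have "R (v, 0) (v', 0)" using t'(2) by simp
  then show ?thesis
    using unit_sim_update_lab[OF R(1), of v v' x] unit_sim_update_lab[OF R(2), of v' v x]
    unfolding unit_bisimilar_def K(5) K'(5) by blast
qed

section \<open>Invariance under all transformers\<close>

text \<open>Functionality of the results belongs to the conclusion because translating bisimilarity
  back into homeomorphism requires it.\<close>

lemma transform_unit_bisimilar:
  assumes "functional_heap H" "functional_heap H'" "unit_bisimilar H H'"
    and "applicable \<tau> H" "q \<notin> verts H" "q' \<notin> verts H'"
  shows "functional_heap (transform nl q \<tau> H) \<and> functional_heap (transform nl q' \<tau> H') \<and>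
    unit_bisimilar (transform nl q \<tau> H) (transform nl q' \<tau> H')"
proof (cases \<tau>)
  case (New x)
  then show ?thesis using assms functional_heap_new_heap new_heap_unit_bisimilar by auto
next
  case (Assign x y)
  then show ?thesis using assms functional_heap_assign_heap assign_heap_unit_bisimilar by auto
next
  case (Lookup x y)
  then obtain u where u: "(lab H y, u) \<in> edges H" using assms(4) by auto
  obtain u' where u': "(lab H' y, u') \<in> edges H'"
    using unit_bisimilar_edge_from_lab[OF assms(1,3) u] by blast
  show ?thesis
    using Lookup functional_heap_lookup_heap[OF assms(1) u assms(5)]
      functional_heap_lookup_heap[OF assms(2) u' assms(6)]
      lookup_heap_unit_bisimilar[OF assms(1) u assms(5) assms(2) u' assms(6,3)] by simp
next
  case (Update x y)
  then obtain u where u: "(lab H x, u) \<in> edges H" using assms(4) by auto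
  obtain u' where u': "(lab H' x, u') \<in> edges H'"
    using unit_bisimilar_edge_from_lab[OF assms(1,3) u] by blast
  show ?thesis
    using Update functional_heap_update_heap[OF assms(1) u]
      functional_heap_update_heap[OF assms(2) u']
      update_heap_unit_bisimilar[OF assms(1) u assms(2) u' assms(3)] by simp
qed

theorem theorem2:
  fixes nl :: "'p::finite"
  assumes "infinite (UNIV :: 'v set)"
  shows "equiv (sl_heaps nl :: ('p, 'v) heap set)
           {(H, H'). H \<in> sl_heaps nl \<and> H' \<in> sl_heaps nl \<and> H \<sim>\<^sub>h H'} \<and>
         (\<forall>H \<in> (sl_heaps nl :: ('p, 'v) heap set). \<forall>H' \<in> sl_heaps nl. H \<sim>\<^sub>h H' \<longrightarrow>
            (\<forall>x y. path_length H x y = path_length H' x y) \<and>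
            (\<forall>x. circular H x = circular H' x) \<and>
            (\<forall>\<tau> q q'. applicable \<tau> H \<longrightarrow> q \<notin> verts H \<longrightarrow> q' \<notin> verts H' \<longrightarrow>
               transform nl q \<tau> H \<sim>\<^sub>h transform nl q' \<tau> H'))"
proof (intro conjI ballI impI)
  note iff = homeomorphic_iff_unit_bisimilar[OF assms]
  note fnl = functional_heap_if_sl_heap[of _ nl]
  have rel: "{(H :: ('p, 'v) heap, H'). H \<in> sl_heaps nl \<and> H' \<in> sl_heaps nl \<and> H \<sim>\<^sub>h H'} =
      {(H, H'). H \<in> sl_heaps nl \<and> H' \<in> sl_heaps nl \<and> unit_bisimilar H H'}"
    by (simp add: iff fnl cong: conj_cong)
  show "equiv (sl_heaps nl :: ('p, 'v) heap set)
      {(H, H'). H \<in> sl_heaps nl \<and> H' \<in> sl_heaps nl \<and> H \<sim>\<^sub>h H'}"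
    unfolding rel
    by (intro equivI refl_onI symI transI)
      (auto intro: fnl unit_bisimilar_refl unit_bisimilar_sym unit_bisimilar_trans)
  fix H H' :: "('p, 'v) heap"
  assume sl: "H \<in> sl_heaps nl" "H' \<in> sl_heaps nl" and hom: "H \<sim>\<^sub>h H'"
  note fh = fnl[OF sl(1)] fnl[OF sl(2)]
  have bis: "unit_bisimilar H H'" using iff[OF fh] hom by blast
  note steps = unit_bisimilar_relpowp_labels[OF bis]
  show "\<forall>x y. path_length H x y = path_length H' x y"
    using fh steps by (simp add: path_length_eq_unit_steps)
  show "\<forall>x. circular H x = circular H' x"
    using fh steps by (simp add: circular_iff_unit_steps)
  show "\<forall>\<tau> q q'. applicable \<tau> H \<longrightarrow> q \<notin> verts H \<longrightarrow> q' \<notin> verts H' \<longrightarrow>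
      transform nl q \<tau> H \<sim>\<^sub>h transform nl q' \<tau> H'"
    using transform_unit_bisimilar[OF fh bis] iff by blast
qed

end
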